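(* Let $M\in\mathrm{U}(3)$, let $U$ be the associated three-mode linear optical passive transformation, and write $|\psi\rangle=U|11\rangle|0\rangle=\sum_{k=0}^{2}|\phi_k\rangle|k\rangle$, where the second factor refers to the ancillary mode $3$. Assume $|\phi_0\rangle\ne0$, and let $\mathcal{P}_0=\langle\phi_0|\phi_0\rangle$. Let $\eta\in[0,1]$ be the quantum efficiency of an on/off photodetector placed on mode $3$. Let $P_0$ be the probability of the "no click" event, $P_0=\langle\psi|\,\mathbb{I}\otimes\mathbb{I}\otimes\Pi_0(\eta)\,|\psi\rangle$, and let $\varrho_0=\frac1{P_0}\mathrm{Tr}_3\left[|\psi\rangle\langle\psi|\;\mathbb{I}\otimes\mathbb{I}\otimes\Pi_0(\eta)\right]$ be the corresponding conditional state of modes $1,2$. Then the fidelity $F=\langle\phi_0|\varrho_0|\phi_0\rangle/\langle\phi_0|\phi_0\rangle$ to the target state satisfies $$F=\frac{\langle\phi_0|\phi_0\rangle}{\sum_{k=0}^2(1-\eta)^k\langle\phi_k|\phi_k\rangle}=\frac{\mathcal{P}_0}{P_0}.$$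
   Context: Consider three bosonic modes with annihilation and creation operators $a_i,a_i^\dagger$, $[a_i,a_j^\dagger]=\delta_{ij}\mathbb{I}$, $[a_i,a_j]=0$, acting on the three-mode Fock space with vacuum $|000\rangle$. The number states are $|n_1n_2n_3\rangle=\prod_i (a_i^\dagger)^{n_i}/\sqrt{n_i!}\,|000\rangle$, also written $|n_1n_2\rangle|n_3\rangle$. The linear optical passive (LOP) transformation associated with $M\in\mathrm{U}(3)$ is the unitary operator $U$ on Fock space with $U^\dagger a_iU=\sum_j M_{ij}a_j$ and $U|000\rangle=|000\rangle$; it preserves the total photon number. An on/off detector of quantum efficiency $\eta$ on a single mode is described by the two-outcome POVM $\Pi_0(\eta)=\sum_{k=0}^\infty(1-\eta)^k|k\rangle\langle k|$ ("no click") and $\Pi_1(\eta)=\mathbb{I}-\Pi_0(\eta)$ ("click"), with the convention $0^0=1$. $\mathrm{Tr}_3$ is the partial trace over mode $3$. *)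

theory Defs
  imports "HOL-Analysis.Analysis" "HOL-Library.Function_Algebras"
begin

text \<open>
  A Hilbert space with orthonormal basis indexed by \<open>'a\<close> is the carrier \<open>ell2\<close> of
  square-summable functions \<open>'a \<Rightarrow> complex\<close>; operators are functions on vectors that are
  only constrained on \<open>ell2\<close>. Zero, addition and finite sums of vectors are the pointwise ones
  of \<^theory>\<open>HOL-Library.Function_Algebras\<close>.
\<close>

definition ell2 :: "('a \<Rightarrow> complex) set" where
  "ell2 = {f. (\<lambda>x. (cmod (f x))\<^sup>2) summable_on UNIV}"

text \<open>Physics convention: antilinear in the first argument.\<close>

definition braket :: "('a \<Rightarrow> complex) \<Rightarrow> ('a \<Rightarrow> complex) \<Rightarrow> complex" where
  "braket f g = (\<Sum>\<^sub>\<infinity>x. cnj (f x) * g x)"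

definition ket :: "'a \<Rightarrow> 'a \<Rightarrow> complex" where
  "ket n = (\<lambda>x. if x = n then 1 else 0)"

definition ketbra :: "('a \<Rightarrow> complex) \<Rightarrow> ('b \<Rightarrow> complex) \<Rightarrow> ('b \<Rightarrow> complex) \<Rightarrow> ('a \<Rightarrow> complex)" where
  "ketbra u v = (\<lambda>f x. braket v f * u x)"

definition unitary_op :: "(('a \<Rightarrow> complex) \<Rightarrow> ('a \<Rightarrow> complex)) \<Rightarrow> bool" where
  "unitary_op U \<longleftrightarrow>
     U ` ell2 = ell2 \<and>
     (\<forall>f\<in>ell2. \<forall>g\<in>ell2. \<forall>a b. U (\<lambda>x. a * f x + b * g x) = (\<lambda>x. a * U f x + b * U g x)) \<and>
     (\<forall>f\<in>ell2. \<forall>g\<in>ell2. braket (U f) (U g) = braket f g)"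

definition adj_op :: "(('a \<Rightarrow> complex) \<Rightarrow> ('b \<Rightarrow> complex)) \<Rightarrow> ('b \<Rightarrow> complex) \<Rightarrow> ('a \<Rightarrow> complex)" where
  "adj_op U f = (SOME h. h \<in> ell2 \<and> (\<forall>g\<in>ell2. braket h g = braket f (U g)))"

text \<open>\<open>\<ell>\<^sup>2(X \<times> Y)\<close> is the tensor product of \<open>\<ell>\<^sup>2(X)\<close> and \<open>\<ell>\<^sup>2(Y)\<close>.
  The operator \<open>tensor_op A B\<close> is \<open>(A \<otimes> I) \<circ> (I \<otimes> B)\<close>, each factor acting slice-wise.\<close>

definition tensor_vec :: "('a \<Rightarrow> complex) \<Rightarrow> ('b \<Rightarrow> complex) \<Rightarrow> ('a \<times> 'b \<Rightarrow> complex)"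
    (infixr \<open>\<otimes>\<^sub>v\<close> 75) where
  "f \<otimes>\<^sub>v g = (\<lambda>(x, y). f x * g y)"

definition tensor_op :: "(('a \<Rightarrow> complex) \<Rightarrow> ('c \<Rightarrow> complex)) \<Rightarrow> (('b \<Rightarrow> complex) \<Rightarrow> ('d \<Rightarrow> complex)) \<Rightarrow>
    ('a \<times> 'b \<Rightarrow> complex) \<Rightarrow> ('c \<times> 'd \<Rightarrow> complex)"
    (infixr \<open>\<otimes>\<^sub>o\<close> 75) where
  "A \<otimes>\<^sub>o B = (\<lambda>\<Psi> (x, y). A (\<lambda>x'. B (\<lambda>y'. \<Psi> (x', y')) y) x)"

text \<open>The partial inner product \<open>(I \<otimes> \<langle>k|) \<Psi>\<close> with a basis vector of the second factor.\<close>

definition pbraket :: "'b \<Rightarrow> ('a \<times> 'b \<Rightarrow> complex) \<Rightarrow> ('a \<Rightarrow> complex)" where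
  "pbraket k \<Psi> = (\<lambda>x. \<Psi> (x, k))"

text \<open>The partial trace over the second factor, \<open>\<Sum>\<^sub>k (I \<otimes> \<langle>k|) A (I \<otimes> |k\<rangle>)\<close>.\<close>

definition ptrace2 :: "(('a \<times> 'b \<Rightarrow> complex) \<Rightarrow> ('a \<times> 'b \<Rightarrow> complex)) \<Rightarrow>
    ('a \<Rightarrow> complex) \<Rightarrow> ('a \<Rightarrow> complex)" where
  "ptrace2 A = (\<lambda>\<xi> x. \<Sum>\<^sub>\<infinity>k. pbraket k (A (\<xi> \<otimes>\<^sub>v ket k)) x)"

text \<open>Three-mode Fock space in the number basis, with modes 1 and 2 grouped.\<close>

type_synonym occ3 = "(nat \<times> nat) \<times> nat"
type_synonym fock3 = "occ3 \<Rightarrow> complex"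

definition vacuum :: fock3 where
  "vacuum = ket ((0, 0), 0)"

definition occ :: "3 \<Rightarrow> occ3 \<Rightarrow> nat" where
  "occ i n = (if i = 1 then fst (fst n) else if i = 2 then snd (fst n) else snd n)"

definition raise_occ :: "3 \<Rightarrow> occ3 \<Rightarrow> occ3" where
  "raise_occ i n = ((fst (fst n) + of_bool (i = 1), snd (fst n) + of_bool (i = 2)), snd n + of_bool (i = 3))"

definition lower_occ :: "3 \<Rightarrow> occ3 \<Rightarrow> occ3" where
  "lower_occ i n = ((fst (fst n) - of_bool (i = 1), snd (fst n) - of_bool (i = 2)), snd n - of_bool (i = 3))"

text \<open>The ladder operators in coordinates; the formulas make sense for every coefficient function,
  and \<open>f \<in> ell2\<close> lies in the domain of \<open>annihilate i\<close> iff \<open>annihilate i f \<in> ell2\<close>.\<close>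

definition annihilate :: "3 \<Rightarrow> fock3 \<Rightarrow> fock3" where
  "annihilate i f = (\<lambda>n. of_real (sqrt (real (occ i n + 1))) * f (raise_occ i n))"

definition create :: "3 \<Rightarrow> fock3 \<Rightarrow> fock3" where
  "create i f = (\<lambda>n. of_real (sqrt (real (occ i n))) * f (lower_occ i n))"

definition finite_particle :: "fock3 set" where
  "finite_particle = {f. finite {n. f n \<noteq> 0}}"

lemmas occ_defs = occ_def raise_occ_def lower_occ_def

lemma mode_cases: "i = 1 \<or> i = 2 \<or> i = (3 :: 3)"
  by (rule exhaust_3)

lemma commutator_annihilate_create:
  "annihilate i (create j f) n - create j (annihilate i f) n = (if i = j then f n else 0)"
proof -
  have s: "complex_of_real (sqrt a) * complex_of_real (sqrt a) = of_real a" if "a \<ge> 0" for a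
    using that by (simp flip: of_real_mult)
  have s': "complex_of_real (sqrt a) * (complex_of_real (sqrt a) * z) = of_real a * z"
    if "a \<ge> 0" for a z
    using s[OF that] by (simp flip: mult.assoc)
  obtain a b c where n: "n = ((a, b), c)" by (metis prod.collapse)
  show ?thesis
    using mode_cases[of i] mode_cases[of j]
    by (cases a; cases b; cases c)
       (auto simp: n annihilate_def create_def occ_defs s s' algebra_simps)
qed

lemma commutator_annihilate: "annihilate i (annihilate j f) = annihilate j (annihilate i f)"
  using mode_cases[of i] mode_cases[of j]
  by (auto simp: annihilate_def occ_defs fun_eq_iff)

lemma create_ket:
  "create i (ket n) = (\<lambda>x. of_real (sqrt (real (occ i n + 1))) * ket (raise_occ i n) x)"
proof
  fix x :: occ3
  obtain a b c where x: "x = ((a, b), c)" by (metis prod.collapse)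
  obtain p q r where n: "n = ((p, q), r)" by (metis prod.collapse)
  show "create i (ket n) x = of_real (sqrt (real (occ i n + 1))) * ket (raise_occ i n) x"
    using mode_cases[of i]
    by (cases a; cases b; cases c) (auto simp: x n create_def ket_def occ_defs)
qed

lemma create_scale: "create i (\<lambda>x. c * f x) = (\<lambda>x. c * create i f x)"
  by (auto simp: create_def)

lemma create_funpow_ket:
  assumes "occ i n = 0"
  shows "(create i ^^ k) (ket n) =
    (\<lambda>x. of_real (sqrt (fact k)) * ket ((raise_occ i ^^ k) n) x)"
proof (induction k)
  case 0
  show ?case by simp
next
  case (Suc k)
  have "occ i ((raise_occ i ^^ k) n) = k"
    using assms mode_cases[of i] by (induction k) (auto simp: occ_defs)
  then show ?case
    by (simp add: Suc create_scale create_ket real_sqrt_mult mult_ac)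
qed

lemma number_state:
  "ket ((p, q), r) = (\<lambda>x. (create 1 ^^ p) ((create 2 ^^ q) ((create 3 ^^ r) vacuum)) x /
      of_real (sqrt (fact p) * sqrt (fact q) * sqrt (fact r)))"
proof -
  have r1: "(raise_occ 1 ^^ k) ((a, b), c) = ((a + k, b), c)" for k a b c
    by (induction k) (auto simp: occ_defs)
  have r2: "(raise_occ 2 ^^ k) ((a, b), c) = ((a, b + k), c)" for k a b c
    by (induction k) (auto simp: occ_defs)
  have r3: "(raise_occ 3 ^^ k) ((a, b), c) = ((a, b), c + k)" for k a b c
    by (induction k) (auto simp: occ_defs)
  have sc: "(create i ^^ k) (\<lambda>x. c * f x) = (\<lambda>x. c * (create i ^^ k) f x)" for i k c f
    by (induction k) (auto simp: create_scale)
  have "(create 1 ^^ p) ((create 2 ^^ q) ((create 3 ^^ r) vacuum)) =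
      (\<lambda>x. of_real (sqrt (fact r)) * (of_real (sqrt (fact q)) *
        (of_real (sqrt (fact p)) * ket ((p, q), r) x)))"
    unfolding vacuum_def
    by (simp add: create_funpow_ket occ_def r1 r2 r3 sc)
  then show ?thesis
    by (simp add: field_simps)
qed

definition unitary_mat :: "complex^'n^'n \<Rightarrow> bool" where
  "unitary_mat M \<longleftrightarrow>
     M ** (\<chi> i j. cnj (M $ j $ i)) = mat 1 \<and> (\<chi> i j. cnj (M $ j $ i)) ** M = mat 1"

text \<open>The operator identity \<open>U\<^sup>\<dagger> a\<^sub>i U = \<Sum>\<^sub>j M\<^sub>i\<^sub>j a\<^sub>j\<close> involves unbounded operators; it is
  imposed on the finite-particle vectors, a common core of the operators on both sides.\<close>

definition LOP :: "complex^3^3 \<Rightarrow> (fock3 \<Rightarrow> fock3) \<Rightarrow> bool" where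
  "LOP M U \<longleftrightarrow>
     unitary_op U \<and>
     U vacuum = vacuum \<and>
     (\<forall>i. \<forall>f\<in>finite_particle.
        annihilate i (U f) \<in> ell2 \<and>
        adj_op U (annihilate i (U f)) = (\<lambda>n. \<Sum>j\<in>UNIV. M $ i $ j * annihilate j f n))"

text \<open>The convention \<open>0 ^ 0 = 1\<close> is that of the library.\<close>

definition no_click :: "real \<Rightarrow> (nat \<Rightarrow> complex) \<Rightarrow> (nat \<Rightarrow> complex)" where
  "no_click \<eta> f = (\<lambda>n. \<Sum>\<^sub>\<infinity>k. of_real ((1 - \<eta>) ^ k) * ketbra (ket k) (ket k) f n)"

definition no_click_prob :: "real \<Rightarrow> fock3 \<Rightarrow> complex" where
  "no_click_prob \<eta> \<psi> = braket \<psi> (((id \<otimes>\<^sub>o id) \<otimes>\<^sub>o no_click \<eta>) \<psi>)"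

definition no_click_state :: "real \<Rightarrow> fock3 \<Rightarrow> (nat \<times> nat \<Rightarrow> complex) \<Rightarrow> (nat \<times> nat \<Rightarrow> complex)" where
  "no_click_state \<eta> \<psi> = (\<lambda>\<xi> x. 1 / no_click_prob \<eta> \<psi> *
     ptrace2 (ketbra \<psi> \<psi> \<circ> ((id \<otimes>\<^sub>o id) \<otimes>\<^sub>o no_click \<eta>)) \<xi> x)"

definition fidelity_to :: "('a \<Rightarrow> complex) \<Rightarrow> (('a \<Rightarrow> complex) \<Rightarrow> ('a \<Rightarrow> complex)) \<Rightarrow> complex" where
  "fidelity_to \<phi> \<rho> = braket \<phi> (\<rho> \<phi>) / braket \<phi> \<phi>"

end

theory Submission
  imports Defs
begin

text \<open>
  The intertwining relation \<open>a\<^sub>i U = U \<Sum>\<^sub>j M\<^sub>i\<^sub>j a\<^sub>j\<close>, iterated down to the vacuum, shows that \<open>U\<close>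
  preserves the total photon number. Hence \<open>\<phi>\<^sub>k\<close> carries exactly \<open>2 - k\<close> photons: the \<open>\<phi>\<^sub>k\<close> vanish
  for \<open>k > 2\<close> and are mutually orthogonal, so only the \<open>k = 0\<close> term of
  \<open>\<rho>\<^sub>0 = P\<^sub>0\<^sup>-\<^sup>1 \<Sum>\<^sub>k (1 - \<eta>)\<^sup>k |\<phi>\<^sub>k\<rangle>\<langle>\<phi>\<^sub>k|\<close> contributes to the fidelity.
\<close>

section \<open>Scalar products with finite support, and the adjoint of a unitary\<close>

lemma braket_finite_support:
  assumes "finite A" "\<And>x. x \<notin> A \<Longrightarrow> f x = 0"
  shows "braket f g = (\<Sum>x\<in>A. cnj (f x) * g x)"
proof -
  have "braket f g = (\<Sum>\<^sub>\<infinity>x\<in>A. cnj (f x) * g x)"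
    unfolding braket_def by (rule infsum_cong_neutral) (use assms in auto)
  then show ?thesis using assms by simp
qed

lemma braket_ket_left: "braket (ket n) f = f n"
  by (subst braket_finite_support[of "{n}"]) (auto simp: ket_def)

lemma infsum_singleton:
  fixes f :: "'a \<Rightarrow> complex"
  assumes "\<And>x. x \<noteq> a \<Longrightarrow> f x = 0"
  shows "infsum f UNIV = f a"
proof -
  have "infsum f UNIV = infsum f {a}"
    by (rule infsum_cong_neutral) (use assms in auto)
  then show ?thesis by simp
qed

lemma braket_ket_right: "braket f (ket n) = cnj (f n)"
  unfolding braket_def by (subst infsum_singleton[where a = n]) (auto simp: ket_def)

lemma finite_support_ell2:
  assumes "finite {x. f x \<noteq> 0}"
  shows "f \<in> ell2"
proof -
  have "(\<lambda>x. (cmod (f x))\<^sup>2) summable_on {x. f x \<noteq> 0}"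
    using assms by (rule summable_on_finite)
  then show ?thesis
    unfolding ell2_def mem_Collect_eq
    by (rule summable_on_cong_neutral[THEN iffD1, rotated -1]) auto
qed

lemma ket_ell2: "ket n \<in> ell2"
  by (rule finite_support_ell2) (simp add: ket_def)

text \<open>\<open>adj_op\<close> is a choice, so its value has to be pinned down. Surjectivity
  gives a preimage \<open>h\<close> of \<open>g\<close>, and isometry makes \<open>h\<close> a
  legitimate choice; testing against kets then shows that any choice has the coefficients of
  \<open>h\<close>.\<close>

lemma unitary_op_adj_op:
  assumes U: "unitary_op U" and g: "g \<in> ell2"
  shows "U (adj_op U g) = g"
proof -
  obtain h where h: "h \<in> ell2" "U h = g"
    using U g unfolding unitary_op_def by (metis imageE)
  have adj_h: "\<forall>x\<in>ell2. braket h x = braket g (U x)"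
    using U h unfolding unitary_op_def by metis
  have "adj_op U g \<in> ell2 \<and> (\<forall>x\<in>ell2. braket (adj_op U g) x = braket g (U x))"
    unfolding adj_op_def by (rule someI[of _ h]) (use h adj_h in blast)
  then have "cnj (adj_op U g n) = cnj (h n)" for n
    using adj_h ket_ell2 by (metis braket_ket_right)
  then have "adj_op U g = h" by (simp add: fun_eq_iff)
  then show ?thesis using h by simp
qed

section \<open>Conservation of the photon number\<close>

definition photons :: "occ3 \<Rightarrow> nat" where
  "photons n = fst (fst n) + snd (fst n) + snd n"

lemma photons_raise_occ: "photons (raise_occ i n) = Suc (photons n)"
  using mode_cases[of i] by (auto simp: photons_def raise_occ_def)

lemma inj_raise_occ: "inj (raise_occ i)"
  by (auto simp: inj_on_def raise_occ_def prod_eq_iff)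

lemma raise_occ_surj_pos:
  assumes "photons n = Suc k"
  obtains i m where "n = raise_occ i m"
proof -
  obtain a b c where n: "n = ((a, b), c)" by (metis prod.collapse)
  \<comment> \<open>Subtraction truncates at 0, so each disjunct holds exactly when its mode is
    occupied; a positive total forces one of them.\<close>
  have "n = raise_occ 1 ((a - 1, b), c) \<or> n = raise_occ 2 ((a, b - 1), c) \<or>
      n = raise_occ 3 ((a, b), c - 1)"
    using assms by (auto simp: n photons_def raise_occ_def)
  then show ?thesis using that by blast
qed

lemma finite_particle_annihilate:
  assumes "f \<in> finite_particle"
  shows "annihilate i f \<in> finite_particle"
proof -
  have "finite (raise_occ i -` {n. f n \<noteq> 0})"
    using assms inj_raise_occ by (intro finite_vimageI) (auto simp: finite_particle_def)
  then show ?thesis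
    unfolding finite_particle_def mem_Collect_eq
    by (rule rev_finite_subset) (auto simp: annihilate_def)
qed

lemma finite_particle_sum:
  assumes "finite J" "\<And>j. j \<in> J \<Longrightarrow> f j \<in> finite_particle"
  shows "(\<lambda>n. \<Sum>j\<in>J. c j * f j n) \<in> finite_particle"
proof -
  have "finite (\<Union>j\<in>J. {n. f j n \<noteq> 0})"
    using assms by (auto simp: finite_particle_def)
  moreover have "{n. (\<Sum>j\<in>J. c j * f j n) \<noteq> 0} \<subseteq> (\<Union>j\<in>J. {n. f j n \<noteq> 0})"
  proof
    fix n assume "n \<in> {n. (\<Sum>j\<in>J. c j * f j n) \<noteq> 0}"
    then obtain j where "j \<in> J" "c j * f j n \<noteq> 0"
      by (metis (mono_tags, lifting) mem_Collect_eq sum.neutral)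
    then show "n \<in> (\<Union>j\<in>J. {n. f j n \<noteq> 0})" by auto
  qed
  ultimately show ?thesis
    unfolding finite_particle_def mem_Collect_eq by (rule rev_finite_subset)
qed

text \<open>Applying \<open>U\<close> to the defining relation cancels the adjoint. The domain
  clause of \<open>LOP\<close> puts \<open>annihilate i (U f)\<close> into \<open>ell2\<close>,
  where this cancellation is valid.\<close>

lemma LOP_annihilate:
  assumes "LOP M U" "f \<in> finite_particle"
  shows "annihilate i (U f) = U (\<lambda>n. \<Sum>j\<in>UNIV. M $ i $ j * annihilate j f n)"
proof -
  have "unitary_op U" "annihilate i (U f) \<in> ell2"
    and adj: "adj_op U (annihilate i (U f)) = (\<lambda>n. \<Sum>j\<in>UNIV. M $ i $ j * annihilate j f n)"
    using assms unfolding LOP_def by auto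
  then show ?thesis
    using unitary_op_adj_op[of U "annihilate i (U f)"] by (simp only: adj)
qed

text \<open>The coefficient of \<open>U f\<close> at \<open>raise_occ i m\<close> is, up to a
  nonzero factor, that of \<open>annihilate i (U f)\<close> at \<open>m\<close>. Intertwining moves
  the annihilation onto \<open>f\<close>, which lowers the photon shell by one but changes the
  vector; hence the induction generalises over \<open>f\<close>.\<close>

lemma LOP_preserves_photons:
  assumes "LOP M U" "f \<in> finite_particle"
    and "\<And>m. photons m = photons n \<Longrightarrow> f m = 0"
  shows "U f n = 0"
  using assms(2,3)
proof (induction "photons n" arbitrary: n f)
  case 0
  then have "n = ((0, 0), 0)"
    by (auto simp: photons_def prod_eq_iff)
  then have n: "ket n = vacuum"
    by (simp add: vacuum_def)
  have "f \<in> ell2"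
    using 0(2) by (auto simp: finite_particle_def intro: finite_support_ell2)
  \<comment> \<open>Since \<open>U\<close> fixes the vacuum, isometry equates the vacuum
    coefficients of \<open>U f\<close> and \<open>f\<close>.\<close>
  then have "braket (U (ket n)) (U f) = braket (ket n) f"
    using assms(1) ket_ell2[of n] unfolding LOP_def unitary_op_def by blast
  moreover have "U (ket n) = ket n"
    using assms(1) unfolding LOP_def n by blast
  ultimately have "U f n = f n"
    by (simp add: braket_ket_left)
  then show ?case using 0(3) by simp
next
  case (Suc k)
  obtain i m where n: "n = raise_occ i m"
    using Suc.hyps(2) by (metis raise_occ_surj_pos)
  let ?g = "\<lambda>n. \<Sum>j\<in>UNIV. M $ i $ j * annihilate j f n"
  have "U ?g m = 0"
  proof (rule Suc.hyps(1))
    show "k = photons m" using Suc.hyps(2) by (simp add: n photons_raise_occ)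
    show "?g \<in> finite_particle"
      using Suc.prems(1) by (intro finite_particle_sum finite_particle_annihilate) auto
    show "?g m' = 0" if "photons m' = photons m" for m'
      using that Suc.prems(2) by (simp add: annihilate_def n photons_raise_occ)
  qed
  then have "annihilate i (U f) m = 0"
    using LOP_annihilate[OF assms(1) Suc.prems(1)] by simp
  \<comment> \<open>Left unexpanded, \<open>real (occ i m + 1)\<close> is visibly nonzero, so the
    square root cancels.\<close>
  then show ?case by (simp add: annihilate_def n del: of_nat_add of_nat_Suc)
qed

section \<open>The no-click measurement in coordinates\<close>

lemma no_click_apply: "no_click \<eta> f n = of_real ((1 - \<eta>) ^ n) * f n"
  unfolding no_click_def ketbra_def braket_ket_left
  by (subst infsum_singleton[where a = n]) (auto simp: ket_def)

lemma id_tensor_no_click_apply: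
  "((id \<otimes>\<^sub>o id) \<otimes>\<^sub>o no_click \<eta>) \<Psi> (x, k) = of_real ((1 - \<eta>) ^ k) * \<Psi> (x, k)"
  by (cases x) (simp add: tensor_op_def no_click_apply)

text \<open>A box around the support of \<open>\<psi>\<close> makes all sums finite, so they may be
  exchanged; summing over modes 1 and 2 first leaves the squared norms of the slices.\<close>

lemma no_click_prob_finite:
  assumes "finite A" "finite K" "\<And>x k. (x, k) \<notin> A \<times> K \<Longrightarrow> \<psi> (x, k) = 0"
  shows "no_click_prob \<eta> \<psi> =
    (\<Sum>k\<in>K. of_real ((1 - \<eta>) ^ k) * braket (pbraket k \<psi>) (pbraket k \<psi>))"
proof -
  have "no_click_prob \<eta> \<psi> =
      (\<Sum>(x, k)\<in>A \<times> K. cnj (\<psi> (x, k)) * (of_real ((1 - \<eta>) ^ k) * \<psi> (x, k)))"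
    unfolding no_click_prob_def
    by (subst braket_finite_support[of "A \<times> K"])
       (use assms in \<open>auto simp: id_tensor_no_click_apply intro!: sum.cong\<close>)
  also have "\<dots> = (\<Sum>k\<in>K. \<Sum>x\<in>A. cnj (\<psi> (x, k)) * (of_real ((1 - \<eta>) ^ k) * \<psi> (x, k)))"
    by (subst sum.swap) (simp add: sum.cartesian_product)
  also have "\<dots> = (\<Sum>k\<in>K. of_real ((1 - \<eta>) ^ k) * braket (pbraket k \<psi>) (pbraket k \<psi>))"
  proof (rule sum.cong[OF refl])
    fix k
    have "braket (pbraket k \<psi>) (pbraket k \<psi>) = (\<Sum>x\<in>A. cnj (\<psi> (x, k)) * \<psi> (x, k))"
      by (subst braket_finite_support[of A]) (use assms in \<open>auto simp: pbraket_def\<close>)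
    then show "(\<Sum>x\<in>A. cnj (\<psi> (x, k)) * (of_real ((1 - \<eta>) ^ k) * \<psi> (x, k))) =
        of_real ((1 - \<eta>) ^ k) * braket (pbraket k \<psi>) (pbraket k \<psi>)"
      by (simp add: sum_distrib_left mult_ac)
  qed
  finally show ?thesis .
qed

text \<open>This is the mixture of the \<open>|\<phi>_k><\<phi>_k|\<close> with weights
  \<open>(1 - \<eta>) ^ k\<close>, divided by the no-click probability. The finite support of
  \<open>\<psi>\<close> handles convergence, so \<open>\<xi>\<close> can be arbitrary.\<close>

lemma no_click_state_finite:
  assumes "finite A" "finite K" "\<And>x k. (x, k) \<notin> A \<times> K \<Longrightarrow> \<psi> (x, k) = 0"
  shows "no_click_state \<eta> \<psi> \<xi> x = 1 / no_click_prob \<eta> \<psi> *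
    (\<Sum>k\<in>K. of_real ((1 - \<eta>) ^ k) * braket (pbraket k \<psi>) \<xi> * pbraket k \<psi> x)"
proof -
  have *: "braket \<psi> (((id \<otimes>\<^sub>o id) \<otimes>\<^sub>o no_click \<eta>) (\<xi> \<otimes>\<^sub>v ket k)) =
      of_real ((1 - \<eta>) ^ k) * braket (pbraket k \<psi>) \<xi>" if "k \<in> K" for k
  proof -
    have "braket \<psi> (((id \<otimes>\<^sub>o id) \<otimes>\<^sub>o no_click \<eta>) (\<xi> \<otimes>\<^sub>v ket k)) =
        (\<Sum>(x, l)\<in>A \<times> K. cnj (\<psi> (x, l)) * (of_real ((1 - \<eta>) ^ l) * (\<xi> x * ket k l)))"
      by (subst braket_finite_support[of "A \<times> K"])
         (use assms in \<open>auto simp: id_tensor_no_click_apply tensor_vec_def intro!: sum.cong\<close>)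
    also have "\<dots> = (\<Sum>x\<in>A. \<Sum>l\<in>K. if k = l then cnj (\<psi> (x, k)) * (of_real ((1 - \<eta>) ^ k) * \<xi> x) else 0)"
      by (auto simp: sum.cartesian_product ket_def intro!: sum.cong)
    also have "\<dots> = (\<Sum>x\<in>A. cnj (\<psi> (x, k)) * (of_real ((1 - \<eta>) ^ k) * \<xi> x))"
      using assms(2) that by (simp add: sum.delta)
    also have "\<dots> = of_real ((1 - \<eta>) ^ k) * braket (pbraket k \<psi>) \<xi>"
      by (subst braket_finite_support[of A])
         (use assms in \<open>auto simp: pbraket_def sum_distrib_left mult_ac\<close>)
    finally show ?thesis .
  qed
  have "ptrace2 (ketbra \<psi> \<psi> \<circ> ((id \<otimes>\<^sub>o id) \<otimes>\<^sub>o no_click \<eta>)) \<xi> x =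
      (\<Sum>\<^sub>\<infinity>k\<in>K. of_real ((1 - \<eta>) ^ k) * braket (pbraket k \<psi>) \<xi> * pbraket k \<psi> x)"
    unfolding ptrace2_def
  proof (rule infsum_cong_neutral)
    \<comment> \<open>The output of \<open>ketbra \<psi> \<psi>\<close> is a multiple of
      \<open>\<psi>\<close>, whose slice at such a \<open>k\<close> is zero.\<close>
    fix k assume "k \<in> UNIV - K"
    then show "pbraket k ((ketbra \<psi> \<psi> \<circ> ((id \<otimes>\<^sub>o id) \<otimes>\<^sub>o no_click \<eta>)) (\<xi> \<otimes>\<^sub>v ket k)) x = 0"
      using assms(3) by (simp add: pbraket_def ketbra_def)
  next
    fix k assume "k \<in> UNIV \<inter> K"
    then show "pbraket k ((ketbra \<psi> \<psi> \<circ> ((id \<otimes>\<^sub>o id) \<otimes>\<^sub>o no_click \<eta>)) (\<xi> \<otimes>\<^sub>v ket k)) x =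
        of_real ((1 - \<eta>) ^ k) * braket (pbraket k \<psi>) \<xi> * pbraket k \<psi> x"
      using * by (simp add: pbraket_def ketbra_def)
  qed auto
  then show ?thesis using assms(2) by (simp add: no_click_state_def)
qed

theorem mainTheorem5:
  fixes M :: "complex^3^3"
    and U :: "fock3 \<Rightarrow> fock3"
    and \<eta> :: real
    and \<psi> :: fock3
    and \<phi> :: "nat \<Rightarrow> nat \<times> nat \<Rightarrow> complex"
  assumes "unitary_mat M"
    and "LOP M U"
    and "\<psi> = U (ket (1, 1) \<otimes>\<^sub>v ket 0)"
    and "\<And>k. \<phi> k = pbraket k \<psi>"
    and "\<phi> 0 \<noteq> 0"
    and "0 \<le> \<eta>" and "\<eta> \<le> 1"
  shows "\<psi> = (\<Sum>k\<in>{0..2}. \<phi> k \<otimes>\<^sub>v ket k) \<and>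
    fidelity_to (\<phi> 0) (no_click_state \<eta> \<psi>) =
      braket (\<phi> 0) (\<phi> 0) / (\<Sum>k\<in>{0..2}. of_real ((1 - \<eta>) ^ k) * braket (\<phi> k) (\<phi> k)) \<and>
    fidelity_to (\<phi> 0) (no_click_state \<eta> \<psi>) =
      braket (\<phi> 0) (\<phi> 0) / no_click_prob \<eta> \<psi>"
proof -
  have supp: "\<psi> n = 0" if "photons n \<noteq> 2" for n
    unfolding assms(3)
  proof (rule LOP_preserves_photons[OF assms(2)])
    have eq: "ket (1, 1) \<otimes>\<^sub>v ket 0 = (ket ((1, 1), 0) :: fock3)"
      by (auto simp: tensor_vec_def ket_def)
    show "ket (1, 1) \<otimes>\<^sub>v ket 0 \<in> finite_particle"
      unfolding eq by (simp add: finite_particle_def ket_def)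
    show "(ket (1, 1) \<otimes>\<^sub>v ket 0) m = 0" if "photons m = photons n" for m
      unfolding eq using that \<open>photons n \<noteq> 2\<close> by (auto simp: ket_def photons_def)
  qed
  \<comment> \<open>A product set is wanted, so the two-photon shell is enclosed in a cube.\<close>
  define A :: "(nat \<times> nat) set" where "A = {..2} \<times> {..2}"
  have A: "finite A" by (simp add: A_def)
  have supp_box: "\<psi> (x, k) = 0" if "(x, k) \<notin> A \<times> {0..2}" for x k
    using that by (intro supp, cases x) (auto simp: A_def photons_def)
  have \<phi>: "pbraket k \<psi> = \<phi> k" for k by (simp add: assms(4))
  have \<phi>_apply: "\<phi> k x = \<psi> (x, k)" for k x by (simp add: assms(4) pbraket_def)
  have "\<psi> (x, l) = (\<Sum>k\<in>{0..2}. \<phi> k \<otimes>\<^sub>v ket k) (x, l)" for x l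
  proof -
    have "(\<Sum>k\<in>{0..2}. \<phi> k \<otimes>\<^sub>v ket k) (x, l) = (\<Sum>k\<in>{0..2}. if l = k then \<psi> (x, l) else 0)"
      by (auto simp: numeral_2_eq_2 tensor_vec_def ket_def \<phi>_apply)
    then show ?thesis using supp_box[of x l] by (auto simp: sum.delta)
  qed
  then have decomp: "\<psi> = (\<Sum>k\<in>{0..2}. \<phi> k \<otimes>\<^sub>v ket k)" by (auto simp: fun_eq_iff)
  have P: "no_click_prob \<eta> \<psi> = (\<Sum>k\<in>{0..2}. of_real ((1 - \<eta>) ^ k) * braket (\<phi> k) (\<phi> k))"
    using no_click_prob_finite[of A "{0..2}" \<psi>] A supp_box by (simp add: \<phi>)
  have orth: "braket (\<phi> k) (\<phi> 0) = 0" if "k \<noteq> 0" for k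
  proof -
    \<comment> \<open>The supports are disjoint: \<open>\<phi> 0\<close> lives where modes 1 and 2
      hold two photons, which leaves none for mode 3.\<close>
    have "\<phi> k x = 0 \<or> \<phi> 0 x = 0" for x
      using supp[of "(x, k)"] supp[of "(x, 0)"] that
      by (cases "fst x + snd x = 2") (auto simp: \<phi>_apply photons_def)
    then show ?thesis unfolding braket_def by (intro infsum_0) auto
  qed
  have "no_click_state \<eta> \<psi> (\<phi> 0) =
      (\<lambda>x. 1 / no_click_prob \<eta> \<psi> * (braket (\<phi> 0) (\<phi> 0) * \<phi> 0 x))"
  proof
    fix x
    have "no_click_state \<eta> \<psi> (\<phi> 0) x = 1 / no_click_prob \<eta> \<psi> *
        (\<Sum>k\<in>{0..2}. of_real ((1 - \<eta>) ^ k) * braket (\<phi> k) (\<phi> 0) * \<phi> k x)"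
      using no_click_state_finite[of A "{0..2}" \<psi>] A supp_box by (simp add: \<phi>)
    \<comment> \<open>The surviving weight is \<open>(1 - \<eta>) ^ 0 = 1\<close>, also at
      \<open>\<eta> = 1\<close>.\<close>
    also have "(\<Sum>k\<in>{0..2}. of_real ((1 - \<eta>) ^ k) * braket (\<phi> k) (\<phi> 0) * \<phi> k x) =
        (\<Sum>k\<in>{0}. of_real ((1 - \<eta>) ^ k) * braket (\<phi> k) (\<phi> 0) * \<phi> k x)"
      by (rule sum.mono_neutral_right) (auto simp: orth)
    finally show "no_click_state \<eta> \<psi> (\<phi> 0) x =
        1 / no_click_prob \<eta> \<psi> * (braket (\<phi> 0) (\<phi> 0) * \<phi> 0 x)"
      by simp
  qed
  moreover have "braket (\<phi> 0) (\<lambda>x. c * (d * \<phi> 0 x)) = c * d * braket (\<phi> 0) (\<phi> 0)" for c d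
  proof -
    have "(\<lambda>x. cnj (\<phi> 0 x) * (c * (d * \<phi> 0 x))) = (\<lambda>x. c * d * (cnj (\<phi> 0 x) * \<phi> 0 x))"
      by (simp add: mult_ac)
    then show ?thesis
      unfolding braket_def by (simp only: infsum_cmult_right')
  qed
  \<comment> \<open>One of the two factors \<open>braket (\<phi> 0) (\<phi> 0)\<close> cancels
    against the normalisation in \<open>fidelity_to\<close>.\<close>
  ultimately have "fidelity_to (\<phi> 0) (no_click_state \<eta> \<psi>) =
      braket (\<phi> 0) (\<phi> 0) / no_click_prob \<eta> \<psi>"
    by (simp only: fidelity_to_def) simp
  then show ?thesis using decomp P by simp
qed

end
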